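(* Let $X$ be a real vector space and $C$ a nonempty convex subset of $X$. Let $g_n :C\to \mathbb{R}$, $n\in \mathbb{N}$, be a sequence of convex functions converging pointwise on $C$ to some function $g_{\infty}$. Suppose that $\hat{x}\in C$ is an optimal solution of the problem $$(\mathcal{P}_\infty)\qquad \min g_0(x)\quad\text{subject to } x\in C,\ g_n(x)\le 0\ \ \forall n\geq 1 .$$ Then there exists a sequence of real numbers $(\alpha_{\infty},\alpha_0,\alpha_1,\ldots)$ such that: (i) $\alpha_{\infty}\geq 0$, $\alpha_n\geq 0$ for all $n\in \mathbb{N}$ and $\alpha_{\infty}+\sum_{n\geq 0} \alpha_n=1$; (ii) $\alpha_{\infty} g_{\infty}(\hat{x})=0$ and $\alpha_{n}g_n(\hat{x})= 0$ for all $n\geq 1$; (iii) $\alpha_{\infty} g_{\infty}+\sum_{n\geq 0} \alpha_{n} g_n$ has a global minimum on $C$ at $\hat{x}$. If moreover there exists $w\in C$ such that $\sup_{n\geq 1} \big(g_n(w) -g_n(\hat{x})\big)< 0$, then $\alpha_{0}\neq 0$. In this case, the conditions (i), (ii) and (iii) are necessary and sufficient for $\hat{x}$ to be a solution of $(\mathcal{P}_\infty)$.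
   Context: $\mathbb{N}=\{0,1,2,\ldots\}$. An (optimal) solution of $(\mathcal{P}_\infty)$ is a point $x\in C$ with $g_n(x)\le 0$ for all $n\ge 1$ at which $g_0$ attains its minimum over all such points.
   Formalization: In the last sentence, the equivalence of (i)–(iii) with x̂ being a solution is proved for x̂ feasible (g_n(x̂) ≤ 0 for all n ≥ 1); for arbitrary x̂ in C sufficiency fails, e.g. g_0 = 0, g_n(x) = x on ℝ, x̂ = 2, α_0 = 1. *)

theory Defs
  imports "HOL-Analysis.Analysis"
begin

text \<open>Functions on \<^term>\<open>C\<close> are total functions of which only the values on \<^term>\<open>C\<close> are used.\<close>

definition feasible :: "'a set \<Rightarrow> (nat \<Rightarrow> 'a \<Rightarrow> real) \<Rightarrow> 'a \<Rightarrow> bool" where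
  "feasible C g x \<longleftrightarrow> x \<in> C \<and> (\<forall>n\<ge>1. g n x \<le> 0)"

definition optimal_solution :: "'a set \<Rightarrow> (nat \<Rightarrow> 'a \<Rightarrow> real) \<Rightarrow> 'a \<Rightarrow> bool" where
  "optimal_solution C g x \<longleftrightarrow> is_arg_min (g 0) (feasible C g) x"

definition multipliers :: "real \<Rightarrow> (nat \<Rightarrow> real) \<Rightarrow> bool" where
  "multipliers ainf a \<longleftrightarrow>
     ainf \<ge> 0 \<and> (\<forall>n. a n \<ge> 0) \<and> summable a \<and> ainf + (\<Sum>n. a n) = 1"

definition complementary ::
    "(nat \<Rightarrow> 'a \<Rightarrow> real) \<Rightarrow> ('a \<Rightarrow> real) \<Rightarrow> 'a \<Rightarrow> real \<Rightarrow> (nat \<Rightarrow> real) \<Rightarrow> bool" where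
  "complementary g ginf x ainf a \<longleftrightarrow> ainf * ginf x = 0 \<and> (\<forall>n\<ge>1. a n * g n x = 0)"

text \<open>
  The summability clause is automatic when \<^term>\<open>summable a\<close> holds with nonnegative terms and
  \<^term>\<open>g\<close> converges pointwise on \<^term>\<open>C\<close>; it only makes explicit that the infinite sum is a
  genuine one.
\<close>

definition minimizes_lagrangian ::
    "'a set \<Rightarrow> (nat \<Rightarrow> 'a \<Rightarrow> real) \<Rightarrow> ('a \<Rightarrow> real) \<Rightarrow> 'a \<Rightarrow> real \<Rightarrow> (nat \<Rightarrow> real) \<Rightarrow> bool" where
  "minimizes_lagrangian C g ginf x ainf a \<longleftrightarrow>
     (\<forall>y\<in>C. summable (\<lambda>n. a n * g n y)) \<and>
     is_arg_min (\<lambda>y. ainf * ginf y + (\<Sum>n. a n * g n y)) (\<lambda>y. y \<in> C) x"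

definition optimality_conditions ::
    "'a set \<Rightarrow> (nat \<Rightarrow> 'a \<Rightarrow> real) \<Rightarrow> ('a \<Rightarrow> real) \<Rightarrow> 'a \<Rightarrow> real \<Rightarrow> (nat \<Rightarrow> real) \<Rightarrow> bool" where
  "optimality_conditions C g ginf x ainf a \<longleftrightarrow>
     multipliers ainf a \<and> complementary g ginf x ainf a \<and> minimizes_lagrangian C g ginf x ainf a"

text \<open>
  For \<^term>\<open>g\<close> converging pointwise on \<^term>\<open>C\<close> and \<^term>\<open>x \<in> C\<close>, the real supremum below is over
  a bounded nonempty set, hence the true one.
\<close>

definition slater_at :: "'a set \<Rightarrow> (nat \<Rightarrow> 'a \<Rightarrow> real) \<Rightarrow> 'a \<Rightarrow> bool" where
  "slater_at C g x \<longleftrightarrow> (\<exists>w\<in>C. (SUP n\<in>{1..}. g n w - g n x) < 0)"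

end

(* Weights on the index set {0, 1, 2, ..., infinity} are the Radon probability measures on a compact
   space, and each y in C gives the continuous function n |-> g_n(y) on it (with g_0 shifted by
   g_0(xhat)). Optimality of xhat says that none of these functions is negative everywhere, that is,
   each has a nonnegative integral for some weight; by compactness and a minimax argument
   one weight then works for all y in C. Complementary slackness is forced because at xhat
   itself all terms of the integral are nonpositive. *)
theory Submission
  imports Defs
begin

section \<open>A minimax lemma\<close>

text \<open>If no such \<open>a\<close> existed, the compact convex planar image of \<open>K\<close>
  under \<open>(L y, L z)\<close> would miss the closed first quadrant. A strictly separating line
  has a normal with nonnegative entries; normalised, these are the weights of a convex combination
  of \<open>y\<close> and \<open>z\<close> at which, by convexity, \<open>L\<close> is negative on
  all of \<open>K\<close>. This contradicts \<open>ex\<close>.\<close>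

lemma common_nonneg_pair:
  fixes L :: "'y::real_vector \<Rightarrow> 'b::topological_space \<Rightarrow> real"
  assumes K: "compact K"
    and cont: "\<And>y. y \<in> C \<Longrightarrow> continuous_on K (L y)"
    and cvx: "\<And>a. a \<in> K \<Longrightarrow> convex_on C (\<lambda>y. L y a)"
    and C: "convex C"
    and affine: "\<And>a b t. a \<in> K \<Longrightarrow> b \<in> K \<Longrightarrow> 0 \<le> t \<Longrightarrow> t \<le> 1 \<Longrightarrow>
        \<exists>c\<in>K. \<forall>y\<in>C. L y c = (1 - t) * L y a + t * L y b"
    and ex: "\<And>y. y \<in> C \<Longrightarrow> \<exists>a\<in>K. 0 \<le> L y a"
    and y: "y \<in> C" and z: "z \<in> C"
  shows "\<exists>a\<in>K. 0 \<le> L y a \<and> 0 \<le> L z a"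
proof (rule ccontr)
  assume none: "\<not> ?thesis"
  define T where "T = (\<lambda>a. (L y a, L z a)) ` K"
  define Q :: "(real \<times> real) set" where "Q = {0..} \<times> {0..}"
  have "compact T"
    unfolding T_def by (intro compact_continuous_image continuous_on_Pair cont y z K)
  have "T \<noteq> {}"
    using ex[OF y] by (auto simp: T_def)
  have "convex T"
    unfolding convex_alt
  proof (intro ballI allI impI)
    fix p q and t :: real
    assume "p \<in> T" "q \<in> T" and t: "0 \<le> t \<and> t \<le> 1"
    then obtain a b where ab: "a \<in> K" "b \<in> K" "p = (L y a, L z a)" "q = (L y b, L z b)"
      by (auto simp: T_def)
    with affine[of a b t] t obtain c
      where "c \<in> K" "\<forall>y\<in>C. L y c = (1 - t) * L y a + t * L y b"
      by blast
    with ab y z show "(1 - t) *\<^sub>R p + t *\<^sub>R q \<in> T"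
      by (auto simp: T_def intro!: image_eqI[of _ _ c])
  qed
  have "closed Q"
    unfolding Q_def by (intro closed_Times closed_atLeast)
  have "convex Q"
    unfolding Q_def by (intro convex_Times convex_real_interval)
  have "T \<inter> Q = {}"
    using none by (auto simp: T_def Q_def)
  obtain d \<beta> where d: "\<And>x. x \<in> T \<Longrightarrow> d \<bullet> x < \<beta>" "\<And>x. x \<in> Q \<Longrightarrow> \<beta> < d \<bullet> x"
    using separating_hyperplane_compact_closed
      [OF \<open>convex T\<close> \<open>compact T\<close> \<open>T \<noteq> {}\<close> \<open>convex Q\<close> \<open>closed Q\<close> \<open>T \<inter> Q = {}\<close>]
    by blast
  obtain p q where pq: "d = (p, q)"
    by (cases d)
  have \<beta>: "\<beta> < 0"
    using d(2)[of "(0, 0)"] by (simp add: Q_def pq)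
  \<comment> \<open>For negative \<open>p\<close> the point \<open>(\<beta> / p, 0)\<close> would
    lie in \<open>Q\<close> exactly on the separating line.\<close>
  have "0 \<le> p"
  proof (rule ccontr)
    assume "\<not> 0 \<le> p"
    then show False
      using d(2)[of "(\<beta> / p, 0)"] \<beta> by (simp add: Q_def pq zero_le_divide_iff)
  qed
  have "0 \<le> q"
  proof (rule ccontr)
    assume "\<not> 0 \<le> q"
    then show False
      using d(2)[of "(0, \<beta> / q)"] \<beta> by (simp add: Q_def pq zero_le_divide_iff)
  qed
  have neg: "p * L y a + q * L z a < 0" if "a \<in> K" for a
    using d(1)[of "(L y a, L z a)"] that \<beta> by (auto simp: T_def pq)
  \<comment> \<open>Otherwise \<open>p = q = 0\<close>, and \<open>neg\<close> reads
    \<open>0 < 0\<close> at the point of \<open>K\<close> given by \<open>ex\<close>.\<close>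
  have "p + q \<noteq> 0"
    using ex[OF y] neg \<open>0 \<le> p\<close> \<open>0 \<le> q\<close> by (auto simp: add_nonneg_eq_0_iff)
  then have "0 < p + q"
    using \<open>0 \<le> p\<close> \<open>0 \<le> q\<close> by simp
  define u v where "u = p / (p + q)" and "v = q / (p + q)"
  have uv: "0 \<le> u" "0 \<le> v" "u + v = 1"
    using \<open>0 \<le> p\<close> \<open>0 \<le> q\<close> \<open>0 < p + q\<close> by (simp_all add: u_def v_def flip: add_divide_distrib)
  have "u *\<^sub>R y + v *\<^sub>R z \<in> C"
    using C y z uv by (auto simp: convex_def)
  then obtain a where a: "a \<in> K" "0 \<le> L (u *\<^sub>R y + v *\<^sub>R z) a"
    using ex by blast
  have "L (u *\<^sub>R y + v *\<^sub>R z) a \<le> u * L y a + v * L z a"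
    using cvx[OF a(1)] y z uv by (auto simp: convex_on_def)
  also have "\<dots> = (p * L y a + q * L z a) / (p + q)"
    by (simp add: u_def v_def add_divide_distrib)
  also have "\<dots> < 0"
    using neg[OF a(1)] \<open>0 < p + q\<close> by (simp add: divide_neg_pos)
  finally show False
    using a(2) by simp
qed

text \<open>Affinity of \<^term>\<open>L y\<close> is expressed by the existence of a suitable \<^term>\<open>c\<close>, since \<^term>\<open>P\<close>
  need not lie in a vector space; this form passes to the subsets cut out by
  \<^prop>\<open>0 \<le> L y a\<close>.\<close>

lemma minimax_nonneg:
  fixes L :: "'y::real_vector \<Rightarrow> 'b::topological_space \<Rightarrow> real"
  assumes P: "compact P" "closed P"
    and cont: "\<And>y. y \<in> C \<Longrightarrow> continuous_on P (L y)"
    and cvx: "\<And>a. a \<in> P \<Longrightarrow> convex_on C (\<lambda>y. L y a)"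
    and C: "convex C"
    and affine: "\<And>a b t. a \<in> P \<Longrightarrow> b \<in> P \<Longrightarrow> 0 \<le> t \<Longrightarrow> t \<le> 1 \<Longrightarrow>
        \<exists>c\<in>P. \<forall>y\<in>C. L y c = (1 - t) * L y a + t * L y b"
    and ex: "\<And>y. y \<in> C \<Longrightarrow> \<exists>a\<in>P. 0 \<le> L y a"
    and ne: "C \<noteq> {}"
  shows "\<exists>a\<in>P. \<forall>y\<in>C. 0 \<le> L y a"
proof -
  define S where "S y = P \<inter> L y -` {0..}" for y
  have S_closed: "closed (S y)" if "y \<in> C" for y
    unfolding S_def by (intro continuous_closed_preimage cont that P closed_atLeast)
  \<comment> \<open>The extra point \<open>y\<close> strengthens the induction: the hypothesis for
    \<open>F\<close> says that every \<open>L y\<close> is nonnegative somewhere on the set cut out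
    by \<open>F\<close>, which is the premise \<open>ex\<close> that the pair lemma needs
    there.\<close>
  have finite_case: "\<forall>y\<in>C. \<exists>a\<in>P \<inter> (\<Inter>z\<in>F. S z). 0 \<le> L y a" if "finite F" "F \<subseteq> C" for F
    using that
  proof induction
    case empty
    then show ?case using ex by simp
  next
    case (insert z F)
    let ?K = "P \<inter> (\<Inter>z\<in>F. S z)"
    show ?case
    proof
      fix y assume y: "y \<in> C"
      have "\<exists>a\<in>?K. 0 \<le> L y a \<and> 0 \<le> L z a"
      proof (rule common_nonneg_pair[where C = C])
        show "compact ?K"
          using insert.prems by (intro compact_Int_closed P closed_INT) (auto intro: S_closed)
        show "continuous_on ?K (L y)" if "y \<in> C" for y
          using cont[OF that] by (rule continuous_on_subset) auto
        show "convex_on C (\<lambda>y. L y a)" if "a \<in> ?K" for a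
          using cvx that by blast
        show "\<exists>c\<in>?K. \<forall>y\<in>C. L y c = (1 - t) * L y a + t * L y b"
          if ab: "a \<in> ?K" "b \<in> ?K" and t: "0 \<le> t" "t \<le> 1" for a b t
        proof -
          obtain c where c: "c \<in> P" "\<forall>y\<in>C. L y c = (1 - t) * L y a + t * L y b"
            using affine[of a b t] ab t by blast
          \<comment> \<open>\<open>L x c\<close> is a convex combination of two nonnegative numbers,
            so the cut-out set inherits affinity.\<close>
          have "c \<in> S x" if "x \<in> F" for x
          proof -
            have "0 \<le> L x a" "0 \<le> L x b" "x \<in> C"
              using ab that insert.prems unfolding S_def by blast+
            then show ?thesis
              using c t by (auto simp: S_def)
          qed
          with c show ?thesis by blast
        qed
      qed (use insert C y in auto)
      then obtain a where "a \<in> ?K" "0 \<le> L y a" "0 \<le> L z a"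
        by blast
      then show "\<exists>a\<in>P \<inter> (\<Inter>x\<in>insert z F. S x). 0 \<le> L y a"
        by (intro bexI[of _ a]) (simp_all add: S_def[of z])
    qed
  qed
  have "P \<inter> \<Inter> (S ` C) \<noteq> {}"
  proof (rule compact_imp_fip[OF P(1)])
    show "closed T" if "T \<in> S ` C" for T
      using that S_closed by auto
    show "P \<inter> \<Inter> F' \<noteq> {}" if "finite F'" "F' \<subseteq> S ` C" for F'
    proof -
      obtain F where "F \<subseteq> C" "finite F" "F' = S ` F"
        using finite_subset_image[OF \<open>finite F'\<close> \<open>F' \<subseteq> S ` C\<close>] by blast
      then show ?thesis
        \<comment> \<open>A member of \<open>C\<close> serves as the extra point of
          \<open>finite_case\<close>, also when \<open>F\<close> is empty.\<close>
        using finite_case[of F] ne by fastforce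
    qed
  qed
  then obtain a where "a \<in> P" "\<And>y. y \<in> C \<Longrightarrow> a \<in> S y"
    by blast
  then show ?thesis
    by (auto simp: S_def)
qed

section \<open>Weights on the one-point compactification of the naturals\<close>

text \<open>A probability weight on \<open>\<nat> \<union> {\<infinity>}\<close> is encoded by its restriction to \<open>\<nat>\<close>; the mass at
  \<open>\<infinity>\<close> is the missing \<open>1 - suminf a\<close>.\<close>

definition subprob :: "(nat \<Rightarrow> real) set" where
  "subprob = {a. (\<forall>n. 0 \<le> a n) \<and> (\<forall>N. (\<Sum>n<N. a n) \<le> 1)}"

text \<open>When \<open>l\<close> is the limit of \<open>f\<close>, this is the integral of the
  continuous extension of \<open>f\<close> to infinity.\<close>

definition weighted_mean :: "(nat \<Rightarrow> real) \<Rightarrow> real \<Rightarrow> (nat \<Rightarrow> real) \<Rightarrow> real" where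
  "weighted_mean f l a = (1 - suminf a) * l + (\<Sum>n. a n * f n)"

lemma subprob_summable:
  assumes "a \<in> subprob"
  shows "summable a" "suminf a \<le> 1"
proof -
  show "summable a"
    using assms by (intro summableI_nonneg_bounded[where x = 1]) (auto simp: subprob_def)
  then show "suminf a \<le> 1"
    using assms by (intro suminf_le_const) (auto simp: subprob_def)
qed

lemma summable_mult_convergent:
  fixes a f :: "nat \<Rightarrow> real"
  assumes "summable a" "\<And>n. 0 \<le> a n" "f \<longlonglongrightarrow> l"
  shows "summable (\<lambda>n. a n * f n)"
proof -
  have "Bseq f"
    using assms(3) by (intro convergent_imp_Bseq convergentI)
  then obtain B where B: "\<And>n. norm (f n) \<le> B"
    by (auto simp: Bseq_def)
  have "summable (\<lambda>n. a n * B)"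
    using assms(1) by (rule summable_mult2)
  then show ?thesis
    by (rule summable_comparison_test')
      (use B assms(2) in \<open>auto simp: abs_mult intro!: mult_left_mono\<close>)
qed

lemma subprob_summable_mult:
  assumes "a \<in> subprob" "f \<longlonglongrightarrow> l"
  shows "summable (\<lambda>n. a n * f n)"
  using summable_mult_convergent[OF subprob_summable(1)[OF assms(1)] _ assms(2)] assms(1)
  by (auto simp: subprob_def)

section \<open>Compactness of the weights and continuity of the mean\<close>

text \<open>Bounding partial sums instead of the series makes each defining condition depend on
  finitely many coordinates, hence closed in the product topology.\<close>

lemma closed_subprob: "closed subprob"
proof -
  have "closed {a :: nat \<Rightarrow> real. 0 \<le> a n}" for n
    by (intro closed_Collect_le continuous_intros continuous_on_product_coordinates)
  moreover have "closed {a :: nat \<Rightarrow> real. (\<Sum>n<N. a n) \<le> 1}" for N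
    by (intro closed_Collect_le continuous_intros continuous_on_product_coordinates)
  ultimately show ?thesis
    unfolding subprob_def by (intro closed_Collect_conj closed_Collect_all)
qed

text \<open>Each entry is bounded by a partial sum, so the weights form a closed subset of a cube
  that is compact by Tychonoff.\<close>

lemma compact_subprob: "compact subprob"
proof -
  have "a n \<le> 1" if "a \<in> subprob" for a n
  proof -
    have "a n \<le> (\<Sum>k<Suc n. a k)"
      using that by (intro member_le_sum) (auto simp: subprob_def)
    also have "\<dots> \<le> 1"
      using that unfolding subprob_def by blast
    finally show ?thesis .
  qed
  then have sub: "subprob \<subseteq> (UNIV \<rightarrow>\<^sub>E {0..1})"
    by (auto simp: subprob_def)
  have "compactin (product_topology (\<lambda>_::nat. euclidean :: real topology) UNIV) (UNIV \<rightarrow>\<^sub>E {0..1})"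
    by (simp add: compactin_PiE)
  then have "compact ((UNIV :: nat set) \<rightarrow>\<^sub>E {0..1::real})"
    by (simp add: euclidean_product_topology)
  then have "compact ((UNIV \<rightarrow>\<^sub>E {0..1}) \<inter> subprob)"
    by (rule compact_Int_closed[OF _ closed_subprob])
  then show ?thesis
    using sub by (simp add: Int_absorb1)
qed

text \<open>Subtracting \<open>l\<close> removes the mass at infinity from the formula and leaves a
  series whose factors \<open>f n - l\<close> tend to 0, as the continuity proof needs.\<close>

lemma weighted_mean_centered:
  assumes "a \<in> subprob" "f \<longlonglongrightarrow> l"
  shows "weighted_mean f l a = l + (\<Sum>n. a n * (f n - l))"
proof -
  have "(\<Sum>n. a n * (f n - l)) = (\<Sum>n. a n * f n - a n * l)"
    by (simp add: right_diff_distrib)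
  also have "\<dots> = (\<Sum>n. a n * f n) - (\<Sum>n. a n * l)"
    by (intro suminf_diff[symmetric] subprob_summable_mult[OF assms] summable_mult2
        subprob_summable(1) assms(1))
  also have "(\<Sum>n. a n * l) = suminf a * l"
    by (rule suminf_mult2[symmetric, OF subprob_summable(1)[OF assms(1)]])
  finally show ?thesis
    by (simp add: weighted_mean_def algebra_simps)
qed

text \<open>\<open>suminf a\<close> alone is not continuous in the product topology, since mass can
  escape to infinity. In the centered form the tail factors are small and the total mass is at most
  1, so the truncations \<open>s N\<close>, continuous in finitely many coordinates, converge
  uniformly.\<close>

lemma continuous_on_weighted_mean:
  assumes "f \<longlonglongrightarrow> l"
  shows "continuous_on subprob (weighted_mean f l)"
proof -
  define s where "s N a = l + (\<Sum>n<N. a n * (f n - l))" for N and a :: "nat \<Rightarrow> real"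
  have "uniform_limit subprob s (weighted_mean f l) sequentially"
    unfolding uniform_limit_iff
  proof (intro allI impI)
    fix e :: real assume "0 < e"
    then have "\<forall>\<^sub>F n in sequentially. \<bar>f n - l\<bar> < e / 2"
      using tendstoD[OF assms, of "e / 2"] by (simp add: dist_real_def)
    then obtain N where N: "\<And>n. N \<le> n \<Longrightarrow> \<bar>f n - l\<bar> < e / 2"
      by (auto simp: eventually_sequentially)
    have "dist (s M a) (weighted_mean f l a) < e" if M: "N \<le> M" and a: "a \<in> subprob" for M a
    proof -
      have sum: "summable (\<lambda>n. a n * (f n - l))"
        by (rule subprob_summable_mult[OF a, where l = 0]) (use assms in \<open>simp add: LIM_zero\<close>)
      have a0: "0 \<le> a n" for n
        using a by (simp add: subprob_def)
      have "weighted_mean f l a - s M a = (\<Sum>n. a (n + M) * (f (n + M) - l))"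
        using suminf_split_initial_segment[OF sum, of M]
        by (simp add: weighted_mean_centered[OF a assms] s_def)
      also have "\<bar>\<dots>\<bar> \<le> (\<Sum>n. a (n + M) * (e / 2))"
      proof -
        have le: "norm (a (n + M) * (f (n + M) - l)) \<le> a (n + M) * (e / 2)" for n
          using mult_left_mono[of "\<bar>f (n + M) - l\<bar>" "e / 2" "a (n + M)"] N[of "n + M"] M a0[of "n + M"]
          by (simp add: abs_mult)
        have bound: "summable (\<lambda>n. a (n + M) * (e / 2))"
          by (intro summable_mult2) (simp add: subprob_summable(1)[OF a])
        have norm: "summable (\<lambda>n. norm (a (n + M) * (f (n + M) - l)))"
          by (rule summable_comparison_test'[OF bound]) (use le in simp)
        show ?thesis
          using order_trans[OF summable_norm[OF norm] suminf_le[OF le norm bound]] by simp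
      qed
      also have "\<dots> = (\<Sum>n. a (n + M)) * (e / 2)"
        by (rule suminf_mult2[symmetric]) (simp add: subprob_summable(1)[OF a])
      \<comment> \<open>The tail mass is at most the total mass; the bound 1 does not depend on
        \<open>a\<close>, which gives uniformity.\<close>
      also have "\<dots> \<le> 1 * (e / 2)"
      proof (rule mult_right_mono)
        have "suminf a = (\<Sum>n. a (n + M)) + (\<Sum>n<M. a n)"
          by (rule suminf_split_initial_segment[OF subprob_summable(1)[OF a]])
        moreover have "0 \<le> (\<Sum>n<M. a n)"
          by (intro sum_nonneg a0)
        ultimately show "(\<Sum>n. a (n + M)) \<le> 1"
          using subprob_summable(2)[OF a] by linarith
      qed (use \<open>0 < e\<close> in simp)
      also have "\<dots> < e"
        using \<open>0 < e\<close> by simp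
      finally show ?thesis
        by (simp add: dist_real_def abs_minus_commute)
    qed
    then show "\<forall>\<^sub>F M in sequentially. \<forall>a\<in>subprob. dist (s M a) (weighted_mean f l a) < e"
      by (auto simp: eventually_sequentially)
  qed
  moreover have "continuous_on subprob (s M)" for M
    unfolding s_def
    by (intro continuous_intros continuous_on_subset[OF continuous_on_product_coordinates]) auto
  ultimately show ?thesis
    by (intro uniform_limit_theorem[where f = s and F = sequentially]) auto
qed

section \<open>Affinity in the weight, convexity in the point\<close>

lemma subprob_convex_comb:
  assumes a: "a \<in> subprob" and b: "b \<in> subprob" and t: "0 \<le> t" "t \<le> 1"
  shows "(\<lambda>n. (1 - t) * a n + t * b n) \<in> subprob"
proof -
  have "(\<Sum>n<N. (1 - t) * a n + t * b n) \<le> 1" for N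
  proof -
    have "(\<Sum>n<N. (1 - t) * a n + t * b n) = (1 - t) * (\<Sum>n<N. a n) + t * (\<Sum>n<N. b n)"
      by (simp add: sum.distrib sum_distrib_left)
    also have "\<dots> \<le> (1 - t) * 1 + t * 1"
      using assms by (intro add_mono mult_left_mono) (auto simp: subprob_def)
    finally show ?thesis by simp
  qed
  then show ?thesis
    using assms by (auto simp: subprob_def)
qed

lemma weighted_mean_convex_comb:
  assumes a: "a \<in> subprob" and b: "b \<in> subprob" and f: "f \<longlonglongrightarrow> l"
  shows "weighted_mean f l (\<lambda>n. (1 - t) * a n + t * b n) =
    (1 - t) * weighted_mean f l a + t * weighted_mean f l b"
proof -
  have 1: "(\<lambda>n. (1 - t) * a n + t * b n) sums ((1 - t) * suminf a + t * suminf b)"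
    by (intro sums_add sums_mult summable_sums subprob_summable(1) a b)
  have "(\<lambda>n. (1 - t) * (a n * f n) + t * (b n * f n)) sums
      ((1 - t) * (\<Sum>n. a n * f n) + t * (\<Sum>n. b n * f n))"
    by (intro sums_add sums_mult summable_sums subprob_summable_mult[OF a f]
        subprob_summable_mult[OF b f])
  then have 2: "(\<lambda>n. ((1 - t) * a n + t * b n) * f n) sums
      ((1 - t) * (\<Sum>n. a n * f n) + t * (\<Sum>n. b n * f n))"
    by (simp add: algebra_simps)
  show ?thesis
    unfolding weighted_mean_def sums_unique[OF 1, symmetric] sums_unique[OF 2, symmetric]
    by (simp add: algebra_simps)
qed

text \<open>The comparison at infinity is inherited in the limit; this carries the convexity of the
  \<open>h n\<close> over to the term with \<open>hinf\<close>.\<close>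

lemma weighted_mean_mono:
  assumes a: "a \<in> subprob" and f: "f \<longlonglongrightarrow> l" and f': "f' \<longlonglongrightarrow> l'"
    and le: "\<And>n. f n \<le> f' n"
  shows "weighted_mean f l a \<le> weighted_mean f' l' a"
proof -
  have "l \<le> l'"
    using LIMSEQ_le[OF f f'] le by blast
  then have "(1 - suminf a) * l \<le> (1 - suminf a) * l'"
    using subprob_summable(2)[OF a] by (intro mult_left_mono) auto
  moreover have "(\<Sum>n. a n * f n) \<le> (\<Sum>n. a n * f' n)"
    using a le
    by (intro suminf_le subprob_summable_mult[OF a f] subprob_summable_mult[OF a f'] mult_left_mono)
      (auto simp: subprob_def)
  ultimately show ?thesis
    by (simp add: weighted_mean_def)
qed

lemma weighted_mean_linear:
  assumes a: "a \<in> subprob" and f: "f \<longlonglongrightarrow> l" and f': "f' \<longlonglongrightarrow> l'"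
  shows "weighted_mean (\<lambda>n. u * f n + v * f' n) (u * l + v * l') a =
    u * weighted_mean f l a + v * weighted_mean f' l' a"
proof -
  have "(\<lambda>n. u * (a n * f n) + v * (a n * f' n)) sums
      (u * (\<Sum>n. a n * f n) + v * (\<Sum>n. a n * f' n))"
    by (intro sums_add sums_mult summable_sums subprob_summable_mult[OF a f]
        subprob_summable_mult[OF a f'])
  then have "(\<lambda>n. a n * (u * f n + v * f' n)) sums
      (u * (\<Sum>n. a n * f n) + v * (\<Sum>n. a n * f' n))"
    by (simp add: algebra_simps)
  from sums_unique[OF this, symmetric] show ?thesis
    by (simp add: weighted_mean_def algebra_simps)
qed

text \<open>Dirac weights turn a single index with \<open>0 \<le> h n x\<close> into a weight with
  nonnegative mean.\<close>

lemma point_mass: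
  shows "(\<lambda>n. if n = k then 1 else 0) \<in> subprob"
    and "weighted_mean f l (\<lambda>n. if n = k then 1 else 0) = f k"
proof -
  show "(\<lambda>n. if n = k then 1 else 0) \<in> subprob"
    by (simp add: subprob_def sum.delta)
  have "(\<lambda>n. if n = k then 1 else 0) sums (1::real)"
    using sums_single[of k "\<lambda>_. 1::real"] by simp
  moreover have "(\<lambda>n. (if n = k then 1 else 0) * f n) sums f k"
    using sums_single[of k f] by (simp add: if_distrib[of "\<lambda>x. x * _"] cong: if_cong)
  ultimately show "weighted_mean f l (\<lambda>n. if n = k then 1 else 0) = f k"
    by (simp add: weighted_mean_def flip: sums_unique)
qed

text \<open>Point masses give a suitable weight for each \<open>x\<close> separately;
  \<open>minimax_nonneg\<close> then exchanges the quantifiers.\<close>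

theorem nonneg_weighted_mean_exists:
  fixes C :: "'a::real_vector set" and h :: "nat \<Rightarrow> 'a \<Rightarrow> real"
  assumes C: "C \<noteq> {}" "convex C"
    and h: "\<And>n. convex_on C (h n)"
    and lim: "\<And>x. x \<in> C \<Longrightarrow> (\<lambda>n. h n x) \<longlonglongrightarrow> hinf x"
    and ex: "\<And>x. x \<in> C \<Longrightarrow> \<exists>n. 0 \<le> h n x"
  shows "\<exists>a\<in>subprob. \<forall>x\<in>C. 0 \<le> weighted_mean (\<lambda>n. h n x) (hinf x) a"
proof (rule minimax_nonneg[OF compact_subprob closed_subprob])
  show "continuous_on subprob (weighted_mean (\<lambda>n. h n x) (hinf x))" if "x \<in> C" for x
    by (rule continuous_on_weighted_mean[OF lim[OF that]])
  show "convex_on C (\<lambda>x. weighted_mean (\<lambda>n. h n x) (hinf x) a)" if a: "a \<in> subprob" for a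
    unfolding convex_on_def
  proof (intro conjI C(2) ballI allI impI)
    fix x y and u v :: real
    assume xy: "x \<in> C" "y \<in> C" and uv: "0 \<le> u" "0 \<le> v" "u + v = 1"
    let ?z = "u *\<^sub>R x + v *\<^sub>R y"
    have z: "?z \<in> C"
      using C(2) xy uv by (auto simp: convex_def)
    have "weighted_mean (\<lambda>n. h n ?z) (hinf ?z) a \<le>
        weighted_mean (\<lambda>n. u * h n x + v * h n y) (u * hinf x + v * hinf y) a"
    proof (rule weighted_mean_mono[OF a lim[OF z]])
      show "(\<lambda>n. u * h n x + v * h n y) \<longlonglongrightarrow> u * hinf x + v * hinf y"
        by (intro tendsto_intros lim xy)
      show "h n ?z \<le> u * h n x + v * h n y" for n
        using h[of n] xy uv by (auto simp: convex_on_def)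
    qed
    also have "\<dots> = u * weighted_mean (\<lambda>n. h n x) (hinf x) a + v * weighted_mean (\<lambda>n. h n y) (hinf y) a"
      by (rule weighted_mean_linear[OF a lim[OF xy(1)] lim[OF xy(2)]])
    finally show "weighted_mean (\<lambda>n. h n ?z) (hinf ?z) a \<le> \<dots>" .
  qed
  show "\<exists>c\<in>subprob. \<forall>y\<in>C. weighted_mean (\<lambda>n. h n y) (hinf y) c =
      (1 - t) * weighted_mean (\<lambda>n. h n y) (hinf y) a + t * weighted_mean (\<lambda>n. h n y) (hinf y) b"
    if "a \<in> subprob" "b \<in> subprob" "0 \<le> t" "t \<le> 1" for a b t
    using subprob_convex_comb[OF that] weighted_mean_convex_comb[OF that(1,2) lim] by blast
  show "\<exists>a\<in>subprob. 0 \<le> weighted_mean (\<lambda>n. h n x) (hinf x) a" if "x \<in> C" for x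
    using ex[OF that] point_mass by metis
qed (use C in auto)

section \<open>The optimality conditions\<close>

lemma optimality_conditions_exist:
  fixes C :: "'a::real_vector set" and g :: "nat \<Rightarrow> 'a \<Rightarrow> real"
  assumes C: "convex C"
    and g: "\<And>n. convex_on C (g n)"
    and lim: "\<And>x. x \<in> C \<Longrightarrow> (\<lambda>n. g n x) \<longlonglongrightarrow> ginf x"
    and opt: "optimal_solution C g xhat"
  shows "\<exists>ainf a. optimality_conditions C g ginf xhat ainf a"
proof -
  \<comment> \<open>The shift changes index 0 only, so the limit remains \<open>ginf\<close>, while
    \<open>h 0 xhat = 0\<close>.\<close>
  define c where "c n = (if n = 0 then g 0 xhat else 0)" for n :: nat
  define h where "h n x = g n x - c n" for n x
  have feas: "xhat \<in> C" "\<And>n. 1 \<le> n \<Longrightarrow> g n xhat \<le> 0"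
    and min: "\<And>y. feasible C g y \<Longrightarrow> g 0 xhat \<le> g 0 y"
    using opt by (force simp: optimal_solution_def is_arg_min_linorder feasible_def)+
  have c_lim: "c \<longlonglongrightarrow> 0"
    by (rule tendsto_eventually) (auto simp: c_def eventually_sequentially intro: exI[of _ 1])
  have h_lim: "(\<lambda>n. h n x) \<longlonglongrightarrow> ginf x" if "x \<in> C" for x
    using tendsto_diff[OF lim[OF that] c_lim] by (simp add: h_def)
  \<comment> \<open>If all \<open>h n x\<close> were negative, \<open>x\<close> would be feasible
    with a smaller objective value than \<open>xhat\<close>.\<close>
  have h_nonneg: "\<exists>n. 0 \<le> h n x" if "x \<in> C" for x
  proof (rule ccontr)
    assume "\<not> ?thesis"
    then have neg: "h n x < 0" for n
      by (simp add: not_le)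
    have "feasible C g x"
      unfolding feasible_def
    proof (intro conjI allI impI that)
      show "g n x \<le> 0" if "1 \<le> n" for n
        using neg[of n] that by (simp add: h_def c_def)
    qed
    from min[OF this] show False
      using neg[of 0] by (simp add: h_def c_def)
  qed
  have h_convex: "convex_on C (h n)" for n
    using convex_on_add[OF g[of n], of "\<lambda>_. - c n"] C by (simp add: h_def[abs_def] convex_on_const)
  obtain a where a: "a \<in> subprob"
    and mean: "\<And>x. x \<in> C \<Longrightarrow> 0 \<le> weighted_mean (\<lambda>n. h n x) (ginf x) a"
    using nonneg_weighted_mean_exists[of C h ginf] C feas(1) h_convex h_lim h_nonneg by blast
  define ainf where "ainf = 1 - suminf a"
  have a0: "0 \<le> a n" for n
    using a by (simp add: subprob_def)
  have ainf: "0 \<le> ainf"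
    using subprob_summable(2)[OF a] by (simp add: ainf_def)
  have h_sum: "summable (\<lambda>n. a n * h n x)" if "x \<in> C" for x
    by (rule subprob_summable_mult[OF a h_lim[OF that]])
  have g_sum: "summable (\<lambda>n. a n * g n x)" if "x \<in> C" for x
    by (rule subprob_summable_mult[OF a lim[OF that]])
  \<comment> \<open>Undoing the shift adds a constant independent of \<open>x\<close>, so the
    Lagrangian and the mean have the same minimizers on \<open>C\<close>.\<close>
  have lagrangian: "ainf * ginf x + (\<Sum>n. a n * g n x) =
      weighted_mean (\<lambda>n. h n x) (ginf x) a + a 0 * g 0 xhat" if "x \<in> C" for x
  proof -
    have "(\<lambda>n. a n * c n) sums (a 0 * g 0 xhat)"
      using sums_single[of 0 "\<lambda>n. a n * g 0 xhat"]
      by (simp add: c_def if_distrib[of "\<lambda>x. _ * x"] cong: if_cong)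
    from sums_add[OF summable_sums[OF h_sum[OF that]] this]
    have "(\<lambda>n. a n * g n x) sums ((\<Sum>n. a n * h n x) + a 0 * g 0 xhat)"
      by (simp add: h_def algebra_simps)
    from sums_unique[OF this, symmetric] show ?thesis
      by (simp add: weighted_mean_def ainf_def)
  qed
  have h_le: "h n xhat \<le> 0" for n
    using feas(2)[of n] by (auto simp: h_def c_def)
  then have ginf_le: "ginf xhat \<le> 0"
    using LIMSEQ_le_const2[OF h_lim[OF feas(1)]] by blast
  have terms_le: "a n * h n xhat \<le> 0" for n
    using a0 h_le by (simp add: mult_nonneg_nonpos)
  have sum_le: "(\<Sum>n. a n * h n xhat) \<le> 0"
    using suminf_le[OF terms_le h_sum[OF feas(1)] summable_zero] by simp
  have inf_le: "ainf * ginf xhat \<le> 0"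
    using ainf ginf_le by (simp add: mult_nonneg_nonpos)
  have total: "0 \<le> ainf * ginf xhat + (\<Sum>n. a n * h n xhat)"
    using mean[OF feas(1)] by (simp add: weighted_mean_def ainf_def)
  \<comment> \<open>Two nonpositive numbers with nonnegative sum both vanish.\<close>
  have inf_0: "ainf * ginf xhat = 0" and sum_0: "(\<Sum>n. a n * h n xhat) = 0"
    using total sum_le inf_le by linarith+
  then have mean_0: "weighted_mean (\<lambda>n. h n xhat) (ginf xhat) a = 0"
    by (simp add: weighted_mean_def ainf_def)
  \<comment> \<open>The sign is reversed because a zero sum forces zero terms in a series of
    nonnegative terms.\<close>
  have "\<forall>n. - (a n * h n xhat) = 0"
    using suminf_eq_zero_iff[of "\<lambda>n. - (a n * h n xhat)"] terms_le sum_0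
      summable_minus[OF h_sum[OF feas(1)]] suminf_minus[OF h_sum[OF feas(1)]]
    by simp
  then have "a n * g n xhat = 0" if "1 \<le> n" for n
    using that by (auto simp: h_def c_def split: if_splits dest: spec[of _ n])
  then have "complementary g ginf xhat ainf a"
    using inf_0 by (simp add: complementary_def)
  moreover have "multipliers ainf a"
    using ainf a0 subprob_summable(1)[OF a] by (simp add: multipliers_def ainf_def)
  moreover have "minimizes_lagrangian C g ginf xhat ainf a"
    using feas(1) g_sum mean mean_0
    by (simp add: minimizes_lagrangian_def is_arg_min_linorder lagrangian)
  ultimately show ?thesis
    by (auto simp: optimality_conditions_def)
qed

section \<open>The Slater condition and sufficiency\<close>

text \<open>If \<open>a 0 = 0\<close>, the whole unit mass lies on indices where passing from
  \<open>xhat\<close> to \<open>w\<close> changes the function by at most \<open>s w < 0\<close>,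
  infinity included by taking limits. The Lagrangian at \<open>w\<close> would then be strictly
  below its minimum.\<close>

lemma slater_imp_multiplier_nonzero:
  fixes g :: "nat \<Rightarrow> 'a \<Rightarrow> real"
  assumes lim: "\<And>x. x \<in> C \<Longrightarrow> (\<lambda>n. g n x) \<longlonglongrightarrow> ginf x"
    and x: "xhat \<in> C"
    and slater: "slater_at C g xhat"
    and cond: "optimality_conditions C g ginf xhat ainf a"
  shows "a 0 \<noteq> 0"
proof
  assume zero: "a 0 = 0"
  define s where "s w = (SUP n\<in>{1..}. g n w - g n xhat)" for w
  obtain w where w: "w \<in> C" "s w < 0"
    using slater by (auto simp: slater_at_def s_def)
  have d_lim: "(\<lambda>n. g n w - g n xhat) \<longlonglongrightarrow> ginf w - ginf xhat"
    by (intro tendsto_diff lim x w)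
  \<comment> \<open>Boundedness makes the real \<open>SUP\<close> a genuine upper bound.\<close>
  then have "bdd_above (range (\<lambda>n. g n w - g n xhat))"
    by (rule bounded_imp_bdd_above[OF convergent_imp_bounded])
  then have "bdd_above ((\<lambda>n. g n w - g n xhat) ` {1..})"
    by (rule bdd_above_mono) auto
  then have le: "g n w - g n xhat \<le> s w" if "1 \<le> n" for n
    unfolding s_def using that by (intro cSUP_upper) auto
  then have inf_le: "ginf w - ginf xhat \<le> s w"
    by (intro LIMSEQ_le_const2[OF d_lim]) blast
  have mult: "0 \<le> ainf" "\<And>n. 0 \<le> a n" "summable a" "ainf + suminf a = 1"
    and sums: "\<And>y. y \<in> C \<Longrightarrow> summable (\<lambda>n. a n * g n y)"
    and min: "ainf * ginf xhat + (\<Sum>n. a n * g n xhat) \<le> ainf * ginf w + (\<Sum>n. a n * g n w)"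
    using cond w(1)
    by (auto simp: optimality_conditions_def multipliers_def minimizes_lagrangian_def
        is_arg_min_linorder)
  have "(\<Sum>n. a n * g n w) - (\<Sum>n. a n * g n xhat) = (\<Sum>n. a n * (g n w - g n xhat))"
    using suminf_diff[OF sums[OF w(1)] sums[OF x]] by (simp add: right_diff_distrib)
  also have "\<dots> \<le> (\<Sum>n. a n * s w)"
  proof (rule suminf_le)
    show "a n * (g n w - g n xhat) \<le> a n * s w" for n
      \<comment> \<open>The supremum starts at index 1; at index 0 both sides vanish because
        \<open>a 0 = 0\<close>.\<close>
      using le[of n] mult(2)[of n] zero by (cases "n = 0") (auto intro: mult_left_mono)
    show "summable (\<lambda>n. a n * (g n w - g n xhat))"
      using summable_diff[OF sums[OF w(1)] sums[OF x]] by (simp add: right_diff_distrib)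
    show "summable (\<lambda>n. a n * s w)"
      by (rule summable_mult2[OF mult(3)])
  qed
  also have "\<dots> = suminf a * s w"
    by (rule suminf_mult2[symmetric, OF mult(3)])
  finally have "(\<Sum>n. a n * g n w) - (\<Sum>n. a n * g n xhat) \<le> suminf a * s w" .
  moreover have "ainf * (ginf w - ginf xhat) \<le> ainf * s w"
    by (rule mult_left_mono[OF inf_le mult(1)])
  ultimately have "0 \<le> ainf * s w + suminf a * s w"
    using min by (simp add: right_diff_distrib)
  also have "\<dots> = s w"
    using mult(4) by (simp flip: distrib_right)
  finally show False
    using w(2) by simp
qed

text \<open>By complementarity the Lagrangian at \<open>xhat\<close> is just
  \<open>a 0 * g 0 xhat\<close>, while at a feasible \<open>y\<close> all other terms are
  nonpositive and it is at most \<open>a 0 * g 0 y\<close>. Minimality and division by the positive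
  \<open>a 0\<close> compare the objectives.\<close>

lemma optimality_conditions_sufficient:
  fixes g :: "nat \<Rightarrow> 'a \<Rightarrow> real"
  assumes lim: "\<And>x. x \<in> C \<Longrightarrow> (\<lambda>n. g n x) \<longlonglongrightarrow> ginf x"
    and feas: "feasible C g xhat"
    and cond: "optimality_conditions C g ginf xhat ainf a"
    and nz: "a 0 \<noteq> 0"
  shows "optimal_solution C g xhat"
proof -
  have mult: "0 \<le> ainf" "\<And>n. 0 \<le> a n"
    and sums: "\<And>y. y \<in> C \<Longrightarrow> summable (\<lambda>n. a n * g n y)"
    and min: "\<And>y. y \<in> C \<Longrightarrow>
      ainf * ginf xhat + (\<Sum>n. a n * g n xhat) \<le> ainf * ginf y + (\<Sum>n. a n * g n y)"
    and comp: "ainf * ginf xhat = 0" "\<And>n. 1 \<le> n \<Longrightarrow> a n * g n xhat = 0"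
    using cond
    by (auto simp: optimality_conditions_def multipliers_def minimizes_lagrangian_def
        complementary_def is_arg_min_linorder)
  have "g 0 xhat \<le> g 0 y" if y: "feasible C g y" for y
  proof -
    have yC: "y \<in> C" and gy: "\<And>n. 1 \<le> n \<Longrightarrow> g n y \<le> 0"
      using y by (auto simp: feasible_def)
    have "ginf y \<le> 0"
      using LIMSEQ_le_const2[OF lim[OF yC]] gy by blast
    then have inf_le: "ainf * ginf y \<le> 0"
      using mult(1) by (simp add: mult_nonneg_nonpos)
    have "(\<Sum>n. a n * g n y) = a 0 * g 0 y + (\<Sum>n. a (Suc n) * g (Suc n) y)"
      using suminf_split_head[OF sums[OF yC]] by simp
    moreover have "(\<Sum>n. a (Suc n) * g (Suc n) y) \<le> (\<Sum>n. 0)"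
      using sums[OF yC] gy mult(2)
      by (intro suminf_le) (auto simp: summable_Suc_iff[of "\<lambda>n. a n * g n y"] mult_nonneg_nonpos)
    moreover have "(\<Sum>n. a n * g n xhat) = a 0 * g 0 xhat"
      using suminf_finite[of "{0}" "\<lambda>n. a n * g n xhat"] comp(2) by (simp add: Suc_le_eq)
    ultimately have "a 0 * g 0 xhat \<le> a 0 * g 0 y"
      using min[OF yC] comp(1) inf_le by simp
    then show ?thesis
      using mult(2)[of 0] nz by (simp add: mult_le_cancel_left_pos less_le)
  qed
  then show ?thesis
    using feas by (simp add: optimal_solution_def is_arg_min_linorder)
qed

text \<open>The equivalence concerns feasible \<open>xhat\<close> because the multiplier conditions
  do not imply feasibility: on the real line with \<open>g 0 = 0\<close>, \<open>g n x = x\<close>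
  for positive \<open>n\<close> and \<open>xhat = 1\<close>, they hold with \<open>a 0 = 1\<close>
  and all other multipliers 0, and \<open>w = 0\<close> is a Slater point.\<close>

theorem corollary3:
  fixes C :: "'a::real_vector set"
    and g :: "nat \<Rightarrow> 'a \<Rightarrow> real"
    and ginf :: "'a \<Rightarrow> real"
    and xhat :: 'a
  assumes "C \<noteq> {}" and "convex C"
    and "\<And>n. convex_on C (g n)"
    and "\<And>x. x \<in> C \<Longrightarrow> (\<lambda>n. g n x) \<longlonglongrightarrow> ginf x"
    and "xhat \<in> C"
  shows "(optimal_solution C g xhat \<longrightarrow>
            (\<exists>ainf a. optimality_conditions C g ginf xhat ainf a)) \<and>
         (slater_at C g xhat \<longrightarrow>
            (optimal_solution C g xhat \<longrightarrow>
               (\<forall>ainf a. optimality_conditions C g ginf xhat ainf a \<longrightarrow> a 0 \<noteq> 0)) \<and>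
            (feasible C g xhat \<longrightarrow>
               (optimal_solution C g xhat \<longleftrightarrow>
                  (\<exists>ainf a. optimality_conditions C g ginf xhat ainf a))))"
  using optimality_conditions_exist[of C g ginf xhat] slater_imp_multiplier_nonzero[of C g ginf xhat]
    optimality_conditions_sufficient[of C g ginf xhat] assms
  by blast

end
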